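(* Let $\gamma:I\to M$ be a unit speed curve in a spacelike hypersurface $M\subset\mathbb{R}^4_1$ such that $k_g(s)\neq 0$, $(k_n\tau_2+k_g\tau_g)(s)\neq 0$ and $k_g^2(s)>k_n^2(s)$ for all $s\in I$. Let $H^T_t:I\times H^3(-1)\to\mathbb{R}$, $H^T_t(s,v)=\langle t(s),v\rangle$, be the family of timelike tangential height functions of $\gamma$, and let $S_\gamma:I\times\mathbb{R}\to H^3(-1)$, $$S_\gamma(s,\theta)=\frac{\cosh\theta}{\sqrt{k_g^2(s)-k_n^2(s)}}\bigl(k_g(s)n_\gamma(s)+k_n(s)n_1(s)\bigr)+\sinh\theta\, n_2(s),$$ be the hyperbolic surface of $\gamma$. Then the (image of the) hyperbolic surface $S_\gamma$ is the discriminant set of $H^T_t$, that is, $$S_\gamma(I\times\mathbb{R})=\mathcal{D}_{H^T_t}=\Bigl\{v\in H^3(-1)\ \Big|\ \exists\, s\in I:\ H^T_t(s,v)=\frac{\partial H^T_t}{\partial s}(s,v)=0\Bigr\}.$$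
   Context: $\mathbb{R}^4_1$ is $\mathbb{R}^4$ with $\langle x,y\rangle=-x_0y_0+x_1y_1+x_2y_2+x_3y_3$; a nonzero vector $x$ is spacelike, lightlike or timelike if $\langle x,x\rangle$ is $>0$, $=0$ or $<0$; $\|x\|=\sqrt{|\langle x,x\rangle|}$. With $\{e_0,e_1,e_2,e_3\}$ the canonical basis, $x\wedge y\wedge z$ is the formal determinant with rows $(-e_0,e_1,e_2,e_3),x,y,z$. Hyperbolic space is $H^3(-1)=\{x\in\mathbb{R}^4_1\mid\langle x,x\rangle=-1,\ x_0>0\}$. $U\subset\mathbb{R}^3$ is open, $X:U\to\mathbb{R}^4_1$ is a smooth embedding all of whose nonzero tangent vectors are spacelike, $M=X(U)$ (a spacelike hypersurface), and $n$ is the unit timelike normal field along $M$ which is future directed ($\langle n,e_0\rangle<0$). $I$ is an open interval and $\gamma=X\circ\bar\gamma:I\to M$, with $\bar\gamma:I\to U$ a smooth regular curve, is parametrized by arc length ("unit speed"). Put $t=\gamma'$, $n_\gamma(s)=n(\gamma(s))$, $k_n=-\langle n_\gamma,t'\rangle$, $k_g=\|t'-k_nn_\gamma\|$ and, when $k_g\ne0$ (so $k_g>0$), $n_1=(t'-k_nn_\gamma)/k_g$, $n_2=n_\gamma\wedge t\wedge n_1$, $\tau_1=\langle n_1,n_\gamma'\rangle$, $\tau_2=\langle n_2,n_\gamma'\rangle$, $\tau_g=-\langle n_2',n_1\rangle$. Then $\{n_\gamma,t,n_1,n_2\}$ is a pseudo-orthonormal frame along $\gamma$ with $n_\gamma'=k_nt+\tau_1n_1+\tau_2n_2$,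 $t'=k_nn_\gamma+k_gn_1$, $n_1'=\tau_1n_\gamma-k_gt+\tau_gn_2$, $n_2'=\tau_2n_\gamma-\tau_gn_1$. *)

theory Defs
  imports "HOL-Analysis.Analysis"
begin

text \<open>Minkowski space is \<open>real^4\<close>. The four elements of the index type \<open>4\<close> are written
  \<open>0, 1, 2, 3\<close> (in this type \<open>4 = 0\<close>), so \<open>x $ i\<close> is the coordinate $x_i$ and \<open>axis i 1\<close> is
  the canonical basis vector $e_i$.\<close>

definition mink :: "real^4 \<Rightarrow> real^4 \<Rightarrow> real" where
  "mink x y = - (x $ 0 * y $ 0) + x $ 1 * y $ 1 + x $ 2 * y $ 2 + x $ 3 * y $ 3"

definition spacelike :: "real^4 \<Rightarrow> bool" where
  "spacelike x \<longleftrightarrow> x \<noteq> 0 \<and> mink x x > 0"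

definition timelike :: "real^4 \<Rightarrow> bool" where
  "timelike x \<longleftrightarrow> x \<noteq> 0 \<and> mink x x < 0"

definition mnorm :: "real^4 \<Rightarrow> real" where
  "mnorm x = sqrt \<bar>mink x x\<bar>"

text \<open>The formal determinant with rows $(-e_0, e_1, e_2, e_3), x, y, z$: its $e_i$-coefficient is,
  up to the sign of $e_i$ in the first row, the determinant whose first row is the \<open>i\<close>-th unit row.
  The rows are indexed by \<open>0, 1, 2, 3\<close> in this order, in step with the columns; the library function
  \<open>vector\<close> would place them at \<open>1, 2, 3, 0\<close> and so reverse the sign.\<close>

definition mwedge :: "real^4 \<Rightarrow> real^4 \<Rightarrow> real^4 \<Rightarrow> real^4" where
  "mwedge x y z = (\<chi> i. (if i = 0 then - 1 else 1) *
     det ((\<chi> j. if j = 0 then axis i 1 else if j = 1 then x else if j = 2 then y else z) :: real^4^4))"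

definition hyperbolic_space :: "(real^4) set" where
  "hyperbolic_space = {x. mink x x = - 1 \<and> x $ 0 > 0}"

text \<open>On an open set \<open>S\<close>, \<open>Ck_on k S f\<close> says that all iterated directional derivatives of \<open>f\<close> of
  order at most \<open>k\<close> exist and are continuous.\<close>

primrec Ck_on :: "nat \<Rightarrow> 'a::real_normed_vector set \<Rightarrow> ('a \<Rightarrow> 'b::real_normed_vector) \<Rightarrow> bool" where
  "Ck_on 0 S f \<longleftrightarrow> continuous_on S f"
| "Ck_on (Suc k) S f \<longleftrightarrow> (\<forall>x\<in>S. f differentiable (at x)) \<and>
     (\<forall>v. Ck_on k S (\<lambda>x. frechet_derivative f (at x) v))"

definition smooth_on :: "'a::real_normed_vector set \<Rightarrow> ('a \<Rightarrow> 'b::real_normed_vector) \<Rightarrow> bool" where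
  "smooth_on S f \<longleftrightarrow> (\<forall>k. Ck_on k S f)"

definition smooth_embedding :: "(real^3) set \<Rightarrow> (real^3 \<Rightarrow> real^4) \<Rightarrow> bool" where
  "smooth_embedding U X \<longleftrightarrow> smooth_on U X \<and> (\<forall>u\<in>U. inj (frechet_derivative X (at u))) \<and>
     (\<exists>Y. homeomorphism U (X ` U) X Y)"

text \<open>The tangent space of \<open>X ` U\<close> at \<open>X u\<close> is the range of \<open>frechet_derivative X (at u)\<close>.\<close>

definition spacelike_hypersurface :: "(real^3) set \<Rightarrow> (real^3 \<Rightarrow> real^4) \<Rightarrow> bool" where
  "spacelike_hypersurface U X \<longleftrightarrow> open U \<and> smooth_embedding U X \<and>
     (\<forall>u\<in>U. \<forall>w \<in> range (frechet_derivative X (at u)). w \<noteq> 0 \<longrightarrow> spacelike w)"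

text \<open>No regularity of \<open>n\<close> is required: these conditions determine \<open>n\<close> on \<open>X ` U\<close>.\<close>

definition future_unit_normal ::
    "(real^3) set \<Rightarrow> (real^3 \<Rightarrow> real^4) \<Rightarrow> (real^4 \<Rightarrow> real^4) \<Rightarrow> bool" where
  "future_unit_normal U X n \<longleftrightarrow> (\<forall>u\<in>U.
     (\<forall>w \<in> range (frechet_derivative X (at u)). mink (n (X u)) w = 0) \<and>
     timelike (n (X u)) \<and> mnorm (n (X u)) = 1 \<and> mink (n (X u)) (axis 0 1) < 0)"

definition tangent :: "(real \<Rightarrow> real^4) \<Rightarrow> real \<Rightarrow> real^4" where
  "tangent \<gamma> s = vector_derivative \<gamma> (at s)"

definition regular_curve_on :: "real set \<Rightarrow> (real \<Rightarrow> real^3) \<Rightarrow> bool" where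
  "regular_curve_on I c \<longleftrightarrow> smooth_on I c \<and> (\<forall>s\<in>I. vector_derivative c (at s) \<noteq> 0)"

definition unit_speed_on :: "real set \<Rightarrow> (real \<Rightarrow> real^4) \<Rightarrow> bool" where
  "unit_speed_on I \<gamma> \<longleftrightarrow> (\<forall>s\<in>I. mnorm (tangent \<gamma> s) = 1)"

definition normal_along :: "(real^4 \<Rightarrow> real^4) \<Rightarrow> (real \<Rightarrow> real^4) \<Rightarrow> real \<Rightarrow> real^4" where
  "normal_along n \<gamma> s = n (\<gamma> s)"

definition k_n :: "(real^4 \<Rightarrow> real^4) \<Rightarrow> (real \<Rightarrow> real^4) \<Rightarrow> real \<Rightarrow> real" where
  "k_n n \<gamma> s = - mink (normal_along n \<gamma> s) (vector_derivative (tangent \<gamma>) (at s))"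

definition k_g :: "(real^4 \<Rightarrow> real^4) \<Rightarrow> (real \<Rightarrow> real^4) \<Rightarrow> real \<Rightarrow> real" where
  "k_g n \<gamma> s = mnorm (vector_derivative (tangent \<gamma>) (at s) - k_n n \<gamma> s *\<^sub>R normal_along n \<gamma> s)"

definition n_1 :: "(real^4 \<Rightarrow> real^4) \<Rightarrow> (real \<Rightarrow> real^4) \<Rightarrow> real \<Rightarrow> real^4" where
  "n_1 n \<gamma> s = (1 / k_g n \<gamma> s) *\<^sub>R
     (vector_derivative (tangent \<gamma>) (at s) - k_n n \<gamma> s *\<^sub>R normal_along n \<gamma> s)"

definition n_2 :: "(real^4 \<Rightarrow> real^4) \<Rightarrow> (real \<Rightarrow> real^4) \<Rightarrow> real \<Rightarrow> real^4" where
  "n_2 n \<gamma> s = mwedge (normal_along n \<gamma> s) (tangent \<gamma> s) (n_1 n \<gamma> s)"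

definition tau_2 :: "(real^4 \<Rightarrow> real^4) \<Rightarrow> (real \<Rightarrow> real^4) \<Rightarrow> real \<Rightarrow> real" where
  "tau_2 n \<gamma> s = mink (n_2 n \<gamma> s) (vector_derivative (normal_along n \<gamma>) (at s))"

definition tau_g :: "(real^4 \<Rightarrow> real^4) \<Rightarrow> (real \<Rightarrow> real^4) \<Rightarrow> real \<Rightarrow> real" where
  "tau_g n \<gamma> s = - mink (vector_derivative (n_2 n \<gamma>) (at s)) (n_1 n \<gamma> s)"

definition tangential_height :: "(real \<Rightarrow> real^4) \<Rightarrow> real \<Rightarrow> real^4 \<Rightarrow> real" where
  "tangential_height \<gamma> s v = mink (tangent \<gamma> s) v"

definition discriminant_set :: "real set \<Rightarrow> 'v set \<Rightarrow> (real \<Rightarrow> 'v \<Rightarrow> real) \<Rightarrow> 'v set" where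
  "discriminant_set I V F = {v \<in> V. \<exists>s\<in>I. F s v = 0 \<and> deriv (\<lambda>\<sigma>. F \<sigma> v) s = 0}"

definition hyperbolic_surface ::
    "(real^4 \<Rightarrow> real^4) \<Rightarrow> (real \<Rightarrow> real^4) \<Rightarrow> real \<Rightarrow> real \<Rightarrow> real^4" where
  "hyperbolic_surface n \<gamma> s \<theta> =
     (cosh \<theta> / sqrt ((k_g n \<gamma> s)\<^sup>2 - (k_n n \<gamma> s)\<^sup>2)) *\<^sub>R
       (k_g n \<gamma> s *\<^sub>R normal_along n \<gamma> s + k_n n \<gamma> s *\<^sub>R n_1 n \<gamma> s)
     + sinh \<theta> *\<^sub>R n_2 n \<gamma> s"

end

theory Submission
  imports Defs
begin

text \<open>Fix \<open>s\<close>.  The vectors $n_\gamma, t, n_1$ are pseudo-orthonormal with $n_\gamma$ timelike, and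
  $n_2 = n_\gamma \wedge t \wedge n_1$ completes them to a basis in which every vector is expanded by
  its Minkowski products (\<open>pseudo_orthonormal_expansion\<close>).  Since
  $\partial_s \langle t, v\rangle = \langle t', v\rangle$ and $t' = k_n n_\gamma + k_g n_1$
  (\<open>moving_frame\<close>), the two conditions defining the discriminant set say that \<open>v\<close> has no
  \<open>t\<close>-component and that its $(n_\gamma, n_1)$-part is proportional to $k_g n_\gamma + k_n n_1$.
  Thus $v = q\,(k_g n_\gamma + k_n n_1) + c\, n_2$, and $\langle v, v\rangle = -1$ becomes
  $q^2 (k_g^2 - k_n^2) - c^2 = 1$.  As $k_g^2 > k_n^2$, this is a hyperbola in the $(q, c)$-plane, and the
  requirement that \<open>v\<close> be future directed selects the branch $q > 0$, which is parametrized by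
  $c = \sinh\theta$, $q = \cosh\theta / \sqrt{k_g^2 - k_n^2}$ (\<open>hyperbolic_section_param\<close>).  So for
  each single \<open>s\<close> the curve $\theta \mapsto S_\gamma(s, \theta)$ is exactly the set of \<open>v\<close> in
  hyperbolic space satisfying both conditions at \<open>s\<close>, and the theorem is the union over \<open>s\<close>.

  Two facts about Minkowski space enter: a nonzero vector orthogonal to a timelike one is spacelike,
  which gives $\langle n_1, n_1\rangle = \langle n_2, n_2\rangle = 1$, and the sign of
  $\langle p, q\rangle$ decides whether two timelike vectors lie in the same time cone.\<close>

section \<open>The Minkowski product and the wedge product\<close>

lemma UNIV_4_from_0: "(UNIV :: 4 set) = {0, 1, 2, 3}"
proof -
  have "(4::4) = 0" by simp
  then show ?thesis unfolding UNIV_4 by (simp only: insert_commute)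
qed

lemma sum_4_from_0: "(\<Sum>i\<in>(UNIV :: 4 set). f i) = f 0 + (f 1 + (f 2 + f 3))"
  and prod_4_from_0: "(\<Prod>i\<in>(UNIV :: 4 set). g i) = g 0 * (g 1 * (g 2 * g 3))"
  unfolding UNIV_4_from_0 by simp_all

lemma mink_add_left: "mink (x + y) z = mink x z + mink y z"
  and mink_add_right: "mink x (y + z) = mink x y + mink x z"
  and mink_diff_left: "mink (x - y) z = mink x z - mink y z"
  and mink_diff_right: "mink x (y - z) = mink x y - mink x z"
  and mink_scaleR_left: "mink (r *\<^sub>R x) z = r * mink x z"
  and mink_scaleR_right: "mink x (r *\<^sub>R z) = r * mink x z"
  by (simp_all add: mink_def algebra_simps)

lemmas mink_linear = mink_add_left mink_add_right mink_diff_left mink_diff_right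
  mink_scaleR_left mink_scaleR_right

lemma mink_commute: "mink x y = mink y x"
  by (simp add: mink_def)

lemma bounded_bilinear_mink: "bounded_bilinear mink"
  unfolding bilinear_conv_bounded_bilinear[symmetric] bilinear_def
  by (auto intro!: linearI simp: mink_linear)

lemma all_4_from_0: "(\<forall>i::4. P i) \<longleftrightarrow> P 0 \<and> P 1 \<and> P 2 \<and> P 3"
proof -
  have "(\<forall>i::4. P i) \<longleftrightarrow> (\<forall>i\<in>UNIV. P i)" by simp
  then show ?thesis unfolding UNIV_4_from_0 by simp
qed

definition row_matrix :: "real^4 \<Rightarrow> real^4 \<Rightarrow> real^4 \<Rightarrow> real^4 \<Rightarrow> real^4^4" where
  "row_matrix w x y z = (\<chi> j. if j = 0 then w else if j = 1 then x else if j = 2 then y else z)"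

lemma row_matrix_nth [simp]:
  "row_matrix w x y z $ 0 = w" "row_matrix w x y z $ 1 = x"
  "row_matrix w x y z $ 2 = y" "row_matrix w x y z $ 3 = z"
  by (simp_all add: row_matrix_def)

text \<open>Both sides are linear in \<open>w\<close>; on basis vectors they agree by the definition of the formal
  determinant, whose first row $(-e_0, e_1, e_2, e_3)$ carries the signs of the Minkowski product.\<close>

lemma mink_mwedge: "mink (mwedge x y z) w = det (row_matrix w x y z)"
proof -
  let ?c = "\<lambda>j::4. if j = 1 then x else if j = 2 then y else z"
  have rows: "row_matrix u x y z = (\<chi> j. if j = 0 then u else ?c j)" for u
    by (simp add: row_matrix_def)
  have "w = (\<Sum>i\<in>UNIV. w $ i *s axis i 1)"
    by (simp add: basis_expansion)
  then have "det (row_matrix w x y z)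
      = det (\<chi> j. if j = 0 then (\<Sum>i\<in>UNIV. w $ i *s axis i 1) else ?c j)"
    by (simp only: rows)
  also have "\<dots> = (\<Sum>i\<in>UNIV. w $ i * det (row_matrix (axis i 1) x y z))"
    by (simp add: det_linear_row_sum det_row_mul rows)
  also have "\<dots> = mink (mwedge x y z) w"
    by (simp add: sum_4_from_0 mink_def mwedge_def row_matrix_def)
  finally show ?thesis by simp
qed

lemma mwedge_orthogonal:
  "mink (mwedge x y z) x = 0" "mink (mwedge x y z) y = 0" "mink (mwedge x y z) z = 0"
proof -
  have "row 0 (row_matrix x x y z) = row 1 (row_matrix x x y z)"
       "row 0 (row_matrix y x y z) = row 2 (row_matrix y x y z)"
       "row 0 (row_matrix z x y z) = row 3 (row_matrix z x y z)"
    by (simp_all add: row_def)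
  moreover have "(0::4) \<noteq> 1" "(0::4) \<noteq> 2" "(0::4) \<noteq> 3" by simp_all
  ultimately show "mink (mwedge x y z) x = 0" "mink (mwedge x y z) y = 0" "mink (mwedge x y z) z = 0"
    unfolding mink_mwedge by (blast intro: det_identical_rows)+
qed

text \<open>For a matrix \<open>A\<close> and $J = \mathrm{diag}(-1, 1, 1, 1)$, the matrix $A J A^T$ collects the Minkowski
  products of the rows of \<open>A\<close>; its determinant is $-(\det A)^2$.\<close>

definition mink_matrix :: "real^4^4" where
  "mink_matrix = (\<chi> i j. if i = j then if i = 0 then - 1 else 1 else 0)"

lemma det_mink_matrix: "det mink_matrix = - 1"
proof -
  have "det mink_matrix = (\<Prod>i\<in>UNIV. mink_matrix $ i $ i)"
    by (rule det_diagonal) (simp add: mink_matrix_def)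
  also have "\<dots> = - 1"
    by (simp add: prod_4_from_0 mink_matrix_def)
  finally show ?thesis .
qed

lemma matrix_mult_mink_matrix: "(A ** mink_matrix) $ i $ j = (if j = 0 then - 1 else 1) * A $ i $ j"
  by (simp add: matrix_matrix_mult_def mink_matrix_def if_distrib[of "\<lambda>x. _ * x"] cong: if_cong)

lemma mink_matrix_vector: "(A ** mink_matrix *v u) $ i = mink (A $ i) u"
  by (simp add: matrix_vector_mult_def matrix_mult_mink_matrix sum_4_from_0 mink_def)

lemma gram_matrix: "(A ** mink_matrix ** transpose A) $ i $ j = mink (A $ i) (A $ j)"
  by (simp add: matrix_matrix_mult_def[of "A ** mink_matrix"] matrix_mult_mink_matrix transpose_def
      sum_4_from_0 mink_def)

lemma mink_nondegenerate:
  assumes "det (row_matrix w x y z) \<noteq> 0"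
    and "mink w u = 0" "mink x u = 0" "mink y u = 0" "mink z u = 0"
  shows "u = 0"
proof -
  let ?B = "row_matrix w x y z ** mink_matrix"
  have "?B *v u = 0"
    using assms(2-5) by (simp add: vec_eq_iff all_4_from_0 mink_matrix_vector)
  moreover have "inj ((*v) ?B)"
    using assms(1) by (simp add: inj_matrix_vector_mult invertible_det_nz det_mul det_mink_matrix)
  ultimately show "u = 0"
    by (metis injD matrix_vector_mult_0_right)
qed

text \<open>Three linear conditions on four unknowns: padding with a zero row gives a singular square
  matrix.\<close>

lemma exists_common_orthogonal:
  obtains u where "u \<noteq> 0" "mink x u = 0" "mink y u = 0" "mink z u = 0"
proof -
  let ?B = "row_matrix 0 x y z ** mink_matrix"
  have "row 0 (row_matrix 0 x y z) = 0"
    by (simp add: row_def vec_eq_iff)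
  then have "det (row_matrix 0 x y z) = 0"
    by (rule det_zero_row)
  then have "\<not> inj ((*v) ?B)"
    by (simp add: det_nz_iff_inj[symmetric] det_mul)
  then obtain u where u: "?B *v u = 0" "u \<noteq> 0"
    by (metis matrix_left_invertible_injective matrix_left_invertible_ker)
  have "mink x u = (?B *v u) $ 1" "mink y u = (?B *v u) $ 2" "mink z u = (?B *v u) $ 3"
    by (simp_all add: mink_matrix_vector)
  with u show thesis using that by simp
qed

section \<open>Causal character\<close>

text \<open>The Cauchy-Schwarz inequality for the spatial parts \<open>P\<close>, \<open>Q\<close>: since
  $|P|^2 < p_0^2$ and $|Q|^2 \le q_0^2$, the spatial product is dominated by the time product.
  Strictness needs $q_0 \ne 0$, which holds because \<open>q\<close> would otherwise vanish.\<close>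

lemma spatial_product_less:
  assumes "mink p p < 0" "mink q q \<le> 0" "q \<noteq> 0"
  shows "\<bar>p $ 1 * q $ 1 + p $ 2 * q $ 2 + p $ 3 * q $ 3\<bar> < \<bar>p $ 0 * q $ 0\<bar>"
proof -
  let ?P = "(p $ 1)\<^sup>2 + (p $ 2)\<^sup>2 + (p $ 3)\<^sup>2" and ?Q = "(q $ 1)\<^sup>2 + (q $ 2)\<^sup>2 + (q $ 3)\<^sup>2"
  have P: "?P < (p $ 0)\<^sup>2" and Q: "?Q \<le> (q $ 0)\<^sup>2"
    using assms(1,2) by (simp_all add: mink_def power2_eq_square)
  have q0: "(q $ 0)\<^sup>2 > 0"
  proof (rule ccontr)
    assume "\<not> (q $ 0)\<^sup>2 > 0"
    then have z: "(q $ 0)\<^sup>2 = 0" by simp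
    then have "(q $ 1)\<^sup>2 = 0" "(q $ 2)\<^sup>2 = 0" "(q $ 3)\<^sup>2 = 0"
      using Q by (smt (verit) zero_le_power2)+
    then have "q = 0"
      using z by (simp add: vec_eq_iff all_4_from_0)
    then show False using assms(3) by simp
  qed
  \<comment> \<open>Lagrange's identity: the added terms are the squared components of the cross product.\<close>
  have "(p $ 1 * q $ 1 + p $ 2 * q $ 2 + p $ 3 * q $ 3)\<^sup>2 \<le>
    (p $ 1 * q $ 1 + p $ 2 * q $ 2 + p $ 3 * q $ 3)\<^sup>2 + (p $ 1 * q $ 2 - p $ 2 * q $ 1)\<^sup>2
      + (p $ 1 * q $ 3 - p $ 3 * q $ 1)\<^sup>2 + (p $ 2 * q $ 3 - p $ 3 * q $ 2)\<^sup>2"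
    by simp
  also have "\<dots> = ?P * ?Q"
    by (simp add: power2_eq_square algebra_simps)
  also have "\<dots> \<le> ?P * (q $ 0)\<^sup>2"
    using Q by (intro mult_left_mono) auto
  also have "\<dots> < (p $ 0)\<^sup>2 * (q $ 0)\<^sup>2"
    using P q0 by simp
  finally show ?thesis
    by (simp add: abs_le_square_iff[symmetric] power_mult_distrib[symmetric] linorder_not_le[symmetric])
qed

lemma orthogonal_timelike_imp_spacelike:
  assumes "mink p p < 0" "mink p q = 0" "q \<noteq> 0"
  shows "mink q q > 0"
proof (rule ccontr)
  assume "\<not> mink q q > 0"
  then have "mink q q \<le> 0" by simp
  from spatial_product_less[OF assms(1) this assms(3)] assms(2) show False
    by (simp add: mink_def)
qed

lemma same_time_cone_iff:
  assumes "mink p p < 0" "mink q q < 0" "p $ 0 > 0"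
  shows "mink p q < 0 \<longleftrightarrow> q $ 0 > 0"
proof -
  have "q \<noteq> 0" using assms(2) by (auto simp: mink_def)
  then have *: "\<bar>p $ 1 * q $ 1 + p $ 2 * q $ 2 + p $ 3 * q $ 3\<bar> < \<bar>p $ 0 * q $ 0\<bar>"
    using spatial_product_less assms by simp
  moreover have "mink p q = (p $ 1 * q $ 1 + p $ 2 * q $ 2 + p $ 3 * q $ 3) - p $ 0 * q $ 0"
    by (simp add: mink_def)
  moreover have "p $ 0 * q $ 0 > 0 \<longleftrightarrow> q $ 0 > 0"
    using assms(3) by (simp add: zero_less_mult_iff)
  ultimately show ?thesis by linarith
qed

section \<open>Pseudo-orthonormal frames\<close>

definition pseudo_orthonormal :: "real^4 \<Rightarrow> real^4 \<Rightarrow> real^4 \<Rightarrow> bool" where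
  "pseudo_orthonormal e t m \<longleftrightarrow> mink e e = - 1 \<and> mink t t = 1 \<and> mink m m = 1 \<and>
     mink e t = 0 \<and> mink e m = 0 \<and> mink t m = 0"

text \<open>The Gram matrix of $w, e, t, m$ is diagonal with entries $\langle w, w\rangle, -1, 1, 1$; compare
  determinants.\<close>

lemma det_pseudo_orthonormal:
  assumes "pseudo_orthonormal e t m" "mink w e = 0" "mink w t = 0" "mink w m = 0"
  shows "(det (row_matrix w e t m))\<^sup>2 = mink w w"
proof -
  let ?A = "row_matrix w e t m"
  let ?G = "?A ** mink_matrix ** transpose ?A"
  have "\<forall>i j. i \<noteq> j \<longrightarrow> ?G $ i $ j = 0"
    using assms by (simp add: gram_matrix all_4_from_0 pseudo_orthonormal_def mink_commute)
  then have "det ?G = (\<Prod>i\<in>UNIV. ?G $ i $ i)"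
    by (intro det_diagonal) simp
  also have "\<dots> = - mink w w"
    using assms(1) by (simp add: gram_matrix prod_4_from_0 pseudo_orthonormal_def)
  finally show ?thesis
    by (simp add: det_mul det_mink_matrix power2_eq_square)
qed

text \<open>With \<open>b\<close> for the wedge product and $D = \langle b, b\rangle$, the determinant with rows
  $b, e, t, m$ equals \<open>D\<close>, and by the preceding lemma its square is $\langle b, b\rangle$ as well.
  So $D^2 = D$, and it remains to see $D \ne 0$.  The product of \<open>b\<close> with any nonzero common
  orthogonal vector \<open>u\<close> of $e, t, m$ is nonzero, since its square is $\langle u, u\rangle > 0$; hence
  \<open>b\<close> is nonzero, and being orthogonal to the timelike vector \<open>e\<close> it is spacelike.\<close>

lemma pseudo_orthonormal_mwedge:
  assumes f: "pseudo_orthonormal e t m"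
  shows "mink (mwedge e t m) (mwedge e t m) = 1"
proof -
  obtain u where u: "u \<noteq> 0" "mink e u = 0" "mink t u = 0" "mink m u = 0"
    by (rule exists_common_orthogonal)
  then have "mink u u > 0"
    using orthogonal_timelike_imp_spacelike[of e u] f by (simp add: pseudo_orthonormal_def)
  moreover have "(mink (mwedge e t m) u)\<^sup>2 = mink u u"
    unfolding mink_mwedge
    by (rule det_pseudo_orthonormal[OF f]) (use u mink_commute in metis)+
  ultimately have "mink (mwedge e t m) u \<noteq> 0"
    by auto
  then have "mwedge e t m \<noteq> 0"
    by (auto simp: mink_def)
  then have "mink (mwedge e t m) (mwedge e t m) > 0"
    using orthogonal_timelike_imp_spacelike[of e] f mwedge_orthogonal(1)[of e t m]
    by (simp add: pseudo_orthonormal_def mink_commute)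
  moreover have "(mink (mwedge e t m) (mwedge e t m))\<^sup>2 = mink (mwedge e t m) (mwedge e t m)"
    using det_pseudo_orthonormal[OF f mwedge_orthogonal] by (simp add: mink_mwedge)
  ultimately show ?thesis by (simp add: power2_eq_square)
qed

lemma pseudo_orthonormal_products:
  assumes f: "pseudo_orthonormal e t m"
  shows "mink e e = - 1" "mink t t = 1" "mink m m = 1"
      "mink (mwedge e t m) (mwedge e t m) = 1"
      "mink e t = 0" "mink t e = 0" "mink e m = 0" "mink m e = 0" "mink t m = 0" "mink m t = 0"
      "mink e (mwedge e t m) = 0" "mink (mwedge e t m) e = 0"
      "mink t (mwedge e t m) = 0" "mink (mwedge e t m) t = 0"
      "mink m (mwedge e t m) = 0" "mink (mwedge e t m) m = 0"
  using f mwedge_orthogonal[of e t m] pseudo_orthonormal_mwedge[OF f]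
  by (simp_all add: pseudo_orthonormal_def mink_commute)

text \<open>The difference of the two sides is orthogonal to the whole frame, and the frame has
  determinant $\langle b, b\rangle = 1$ for $b = e \wedge t \wedge m$, so nondegeneracy makes the
  difference vanish.  The minus sign on the \<open>e\<close>-component comes from $\langle e, e\rangle = -1$.\<close>

lemma pseudo_orthonormal_expansion:
  assumes f: "pseudo_orthonormal e t m"
  shows "v = (- mink e v) *\<^sub>R e + mink t v *\<^sub>R t + mink m v *\<^sub>R m
           + mink (mwedge e t m) v *\<^sub>R mwedge e t m"
proof -
  define b where "b = mwedge e t m"
  note prods = pseudo_orthonormal_products[OF f, folded b_def]
  define u where "u = v - ((- mink e v) *\<^sub>R e + mink t v *\<^sub>R t + mink m v *\<^sub>R m + mink b v *\<^sub>R b)"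
  have "mink b u = 0" "mink e u = 0" "mink t u = 0" "mink m u = 0"
    by (simp_all add: u_def mink_linear prods)
  moreover have "det (row_matrix b e t m) \<noteq> 0"
    using prods(4) by (simp add: mink_mwedge[symmetric] b_def)
  ultimately have "u = 0" by (rule mink_nondegenerate[rotated])
  then show ?thesis by (simp add: u_def b_def)
qed

section \<open>The section of hyperbolic space by two orthogonality conditions\<close>

lemma hyperbola_param:
  fixes q c k l :: real
  assumes "q > 0" "k\<^sup>2 < l\<^sup>2" "- (q * l)\<^sup>2 + (q * k)\<^sup>2 + c\<^sup>2 = - 1"
  obtains \<theta> where "c = sinh \<theta>" "q = cosh \<theta> / sqrt (l\<^sup>2 - k\<^sup>2)"
proof -
  define \<theta> where "\<theta> = arsinh c"
  have c: "c = sinh \<theta>" by (simp add: \<theta>_def)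
  have d: "l\<^sup>2 - k\<^sup>2 > 0" using assms(2) by simp
  have "(cosh \<theta>)\<^sup>2 = 1 + c\<^sup>2" by (simp add: c cosh_square_eq)
  also have "\<dots> = q\<^sup>2 * (l\<^sup>2 - k\<^sup>2)" using assms(3) by (simp add: power_mult_distrib right_diff_distrib)
  also have "\<dots> = (q * sqrt (l\<^sup>2 - k\<^sup>2))\<^sup>2"
    using d by (simp add: power_mult_distrib)
  finally have "cosh \<theta> = q * sqrt (l\<^sup>2 - k\<^sup>2)"
    by (rule power2_eq_imp_eq) (use assms(1) d in auto)
  then have "q = cosh \<theta> / sqrt (l\<^sup>2 - k\<^sup>2)"
    using d by simp
  with c show thesis using that by blast
qed

text \<open>For $l = k_g$, $k = k_n$ this is the fibre of the theorem over one parameter \<open>s\<close>.  The vectors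
  orthogonal to \<open>t\<close> and to $k e + l m$ form the plane spanned by $l e + k m$ and the wedge product;
  as $k^2 < l^2$, the vector $l e + k m$ is timelike, so the plane meets hyperbolic space in one branch
  of a hyperbola.\<close>

lemma hyperbolic_section_param:
  fixes k l :: real
  assumes f: "pseudo_orthonormal e t m" and e0: "e $ 0 > 0" and l: "l > 0" and kl: "k\<^sup>2 < l\<^sup>2"
  shows "(\<exists>\<theta>. v = (cosh \<theta> / sqrt (l\<^sup>2 - k\<^sup>2)) *\<^sub>R (l *\<^sub>R e + k *\<^sub>R m) + sinh \<theta> *\<^sub>R mwedge e t m)
    \<longleftrightarrow> v \<in> hyperbolic_space \<and> mink t v = 0 \<and> mink (k *\<^sub>R e + l *\<^sub>R m) v = 0"
    (is "?L \<longleftrightarrow> ?R")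
proof -
  define b where "b = mwedge e t m"
  note prods = pseudo_orthonormal_products[OF f, folded b_def]
  have d: "l\<^sup>2 - k\<^sup>2 > 0" using kl by simp
  show ?thesis
  proof
    assume ?L
    then obtain \<theta> where v: "v = (cosh \<theta> / sqrt (l\<^sup>2 - k\<^sup>2)) *\<^sub>R (l *\<^sub>R e + k *\<^sub>R m) + sinh \<theta> *\<^sub>R b"
      by (auto simp: b_def)
    define r where "r = cosh \<theta> / sqrt (l\<^sup>2 - k\<^sup>2)"
    have r: "r > 0" using d by (simp add: r_def)
    have "r\<^sup>2 * (l\<^sup>2 - k\<^sup>2) = (cosh \<theta>)\<^sup>2"
      using d by (simp add: r_def power_divide)
    then have "r\<^sup>2 * (l\<^sup>2 - k\<^sup>2) - (sinh \<theta>)\<^sup>2 = 1"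
      by (simp add: cosh_square_eq)
    moreover have "mink v v = - (r\<^sup>2 * (l\<^sup>2 - k\<^sup>2) - (sinh \<theta>)\<^sup>2)"
      unfolding v r_def[symmetric]
      by (simp add: mink_linear prods power2_eq_square algebra_simps)
    ultimately have vv: "mink v v = - 1" by simp
    have "mink e v < 0"
      unfolding v r_def[symmetric] using r l by (simp add: mink_linear prods)
    then have "v $ 0 > 0"
      using same_time_cone_iff[of e v] prods(1) e0 vv by simp
    then show ?R
      using vv unfolding hyperbolic_space_def
      by (simp add: v mink_linear prods)
  next
    assume R: ?R
    then have vv: "mink v v = - 1" "v $ 0 > 0" and tv: "mink t v = 0"
      and lv: "k * mink e v + l * mink m v = 0"
      by (simp_all add: hyperbolic_space_def mink_linear)
    \<comment> \<open>\<open>q\<close> is the coefficient of \<open>l e + k m\<close>, positive because \<open>e\<close> and \<open>v\<close> share a time cone.\<close>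
    define q c where "q = - mink e v / l" and "c = mink b v"
    have q: "q > 0"
      using same_time_cone_iff[of e v] prods(1) e0 vv l by (simp add: q_def divide_neg_pos)
    have ev: "mink e v = - (q * l)" and mv: "mink m v = q * k"
      using lv l by (simp_all add: q_def field_simps)
    have v: "v = (q * l) *\<^sub>R e + (q * k) *\<^sub>R m + c *\<^sub>R b"
      using pseudo_orthonormal_expansion[OF f, of v] tv mv ev by (simp add: c_def b_def)
    have "mink v v = - (q * l)\<^sup>2 + (q * k)\<^sup>2 + c\<^sup>2"
      unfolding v by (simp add: mink_linear prods power2_eq_square)
    with vv have "- (q * l)\<^sup>2 + (q * k)\<^sup>2 + c\<^sup>2 = - 1" by simp
    from hyperbola_param[OF q kl this] obtain \<theta>
      where "c = sinh \<theta>" "q = cosh \<theta> / sqrt (l\<^sup>2 - k\<^sup>2)" .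
    then have "v = (cosh \<theta> / sqrt (l\<^sup>2 - k\<^sup>2)) *\<^sub>R (l *\<^sub>R e + k *\<^sub>R m) + sinh \<theta> *\<^sub>R b"
      using v by (simp only: scaleR_add_right scaleR_scaleR)
    then show ?L unfolding b_def by blast
  qed
qed

section \<open>The moving frame of a curve in a spacelike hypersurface\<close>

lemma smooth_on_differentiable:
  assumes "smooth_on S f" "x \<in> S"
  shows "f differentiable (at x)" "(\<lambda>y. frechet_derivative f (at y) v) differentiable (at x)"
proof -
  have "Ck_on (Suc (Suc 0)) S f"
    using assms(1) unfolding smooth_on_def by blast
  with assms(2) show "f differentiable (at x)" "(\<lambda>y. frechet_derivative f (at y) v) differentiable (at x)"
    by auto
qed

lemma smooth_on_vector_derivative:
  fixes c :: "real \<Rightarrow> 'a::real_normed_vector"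
  assumes "smooth_on I c" "s \<in> I"
  shows "(c has_vector_derivative frechet_derivative c (at s) 1) (at s)"
proof -
  let ?D = "frechet_derivative c (at s)"
  have D: "(c has_derivative ?D) (at s)"
    using smooth_on_differentiable(1)[OF assms] by (simp add: frechet_derivative_works)
  have "?D x = x *\<^sub>R ?D 1" for x
    using linear_scale[OF has_derivative_linear[OF D], of x 1] by simp
  then have "?D = (\<lambda>x. x *\<^sub>R ?D 1)" by blast
  with D show ?thesis
    unfolding has_vector_derivative_def by metis
qed

lemma smooth_comp_curve_velocity:
  fixes X :: "'a::real_normed_vector \<Rightarrow> 'b::real_normed_vector"
  assumes "smooth_on U X" "smooth_on I c" "c ` I \<subseteq> U" "s \<in> I"
  shows "(X \<circ> c has_vector_derivative frechet_derivative X (at (c s)) (frechet_derivative c (at s) 1)) (at s)"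
proof -
  have "X differentiable (at (c s))"
    using assms smooth_on_differentiable(1) by blast
  then have "(X has_derivative frechet_derivative X (at (c s))) (at (c s))"
    by (simp add: frechet_derivative_works)
  from vector_derivative_diff_chain_within[OF smooth_on_vector_derivative[OF assms(2,4)]
      has_derivative_at_withinI[OF this]]
  show ?thesis .
qed

text \<open>Smoothness of \<open>X\<close> is expressed through directional derivatives in a fixed direction, whereas the
  velocity $dX_{c(s)}(c'(s))$ has a moving one.  Expanding $c'(s)$ in the standard basis reduces the
  latter to the former.\<close>

lemma smooth_comp_curve_velocity_differentiable:
  fixes X :: "'a::euclidean_space \<Rightarrow> 'b::real_normed_vector"
  assumes X: "smooth_on U X" and I: "open I" and c: "smooth_on I c" and cI: "c ` I \<subseteq> U" and s: "s \<in> I"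
  shows "(\<lambda>\<sigma>. vector_derivative (X \<circ> c) (at \<sigma>)) differentiable (at s)"
proof -
  define g where "g \<sigma> = (\<Sum>b\<in>Basis. (frechet_derivative c (at \<sigma>) 1 \<bullet> b) *\<^sub>R
     frechet_derivative X (at (c \<sigma>)) b)" for \<sigma>
  have eq: "g \<sigma> = vector_derivative (X \<circ> c) (at \<sigma>)" if \<sigma>: "\<sigma> \<in> I" for \<sigma>
  proof -
    let ?w = "frechet_derivative c (at \<sigma>) 1"
    have "X differentiable (at (c \<sigma>))"
      using X cI \<sigma> smooth_on_differentiable(1) by blast
    then have lin: "linear (frechet_derivative X (at (c \<sigma>)))"
      by (rule linear_frechet_derivative)
    have "frechet_derivative X (at (c \<sigma>)) ?w
        = frechet_derivative X (at (c \<sigma>)) (\<Sum>b\<in>Basis. (?w \<bullet> b) *\<^sub>R b)"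
      by (simp only: euclidean_representation)
    also have "\<dots> = g \<sigma>"
      by (simp add: g_def linear_sum[OF lin] linear_scale[OF lin])
    finally show ?thesis
      using vector_derivative_at[OF smooth_comp_curve_velocity[OF X c cI \<sigma>]] by simp
  qed
  have "(\<lambda>\<sigma>. frechet_derivative X (at (c \<sigma>)) b) differentiable (at s)" for b
    using differentiable_chain_at[OF smooth_on_differentiable(1)[OF c s]
        smooth_on_differentiable(2)[OF X, of "c s" b]] cI s
    by (auto simp: o_def)
  moreover have "(\<lambda>\<sigma>. frechet_derivative c (at \<sigma>) 1 \<bullet> b) differentiable (at s)" for b
    using smooth_on_differentiable(2)[OF c s] by simp
  ultimately have "g differentiable (at s)"
    unfolding g_def by (intro differentiable_sum differentiable_scaleR ballI) auto
  then show ?thesis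
    by (metis (no_types, lifting) I eq s differentiable_def has_derivative_transform_within_open)
qed

text \<open>The vector $w = t' - k_n n_\gamma$ is orthogonal to $n_\gamma$ by the choice of $k_n$, and to \<open>t\<close>
  because $\langle t, t\rangle$ is constant.  Orthogonality to the timelike $n_\gamma$ makes \<open>w\<close>
  spacelike once it is nonzero, so the absolute value in $k_g$ can be dropped and
  $\langle n_1, n_1\rangle = +1$.\<close>

lemma moving_frame:
  assumes M: "spacelike_hypersurface U X" and n: "future_unit_normal U X n"
    and I: "open I" and c: "regular_curve_on I c" "c ` I \<subseteq> U" and \<gamma>: "\<gamma> = X \<circ> c"
    and u: "unit_speed_on I \<gamma>" and s: "s \<in> I" and kg: "k_g n \<gamma> s \<noteq> 0"
  shows "(tangent \<gamma> has_vector_derivative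
           k_n n \<gamma> s *\<^sub>R normal_along n \<gamma> s + k_g n \<gamma> s *\<^sub>R n_1 n \<gamma> s) (at s)"
    and "pseudo_orthonormal (normal_along n \<gamma> s) (tangent \<gamma> s) (n_1 n \<gamma> s)"
    and "normal_along n \<gamma> s $ 0 > 0"
    and "k_g n \<gamma> s > 0"
proof -
  have X: "smooth_on U X"
    using M by (simp add: spacelike_hypersurface_def smooth_embedding_def)
  have cs: "smooth_on I c"
    using c(1) by (simp add: regular_curve_on_def)
  define t where "t = tangent \<gamma>"
  define t' where "t' = vector_derivative t (at s)"
  define e where "e = normal_along n \<gamma> s"
  define w where "w = t' - k_n n \<gamma> s *\<^sub>R e"
  \<comment> \<open>Velocities are tangent to \<open>M\<close>, hence spacelike: unit speed then means product \<open>1\<close>, not \<open>-1\<close>.\<close>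
  have t_range: "t \<sigma> \<in> range (frechet_derivative X (at (c \<sigma>)))" if "\<sigma> \<in> I" for \<sigma>
    using vector_derivative_at[OF smooth_comp_curve_velocity[OF X cs c(2) that]]
    by (simp add: t_def tangent_def \<gamma>)
  have tt: "mink (t \<sigma>) (t \<sigma>) = 1" if "\<sigma> \<in> I" for \<sigma>
  proof -
    have unit: "sqrt \<bar>mink (t \<sigma>) (t \<sigma>)\<bar> = 1"
      using u that by (simp add: unit_speed_on_def mnorm_def t_def)
    then have "t \<sigma> \<noteq> 0" by (auto simp: mink_def)
    then have "mink (t \<sigma>) (t \<sigma>) > 0"
      using M t_range[OF that] c(2) that
      by (auto simp: spacelike_hypersurface_def spacelike_def)
    with unit show ?thesis by simp
  qed
  have t': "(t has_vector_derivative t') (at s)"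
    using smooth_comp_curve_velocity_differentiable[OF X I cs c(2) s]
    by (simp add: t'_def t_def tangent_def \<gamma> vector_derivative_works[symmetric]
       tangent_def[abs_def])
  have "((\<lambda>\<sigma>. mink (t \<sigma>) (t \<sigma>)) has_vector_derivative mink (t s) t' + mink t' (t s)) (at s)"
    using bounded_bilinear.has_vector_derivative[OF bounded_bilinear_mink t' t'] .
  moreover have "((\<lambda>\<sigma>. mink (t \<sigma>) (t \<sigma>)) has_vector_derivative 0) (at s)"
    by (rule has_vector_derivative_transform_within_open[OF has_vector_derivative_const I s])
      (simp add: tt)
  ultimately have "mink (t s) t' + mink t' (t s) = 0"
    by (rule vector_derivative_unique_at)
  then have tt': "mink (t s) t' = 0"
    by (simp add: mink_commute)
  have cU: "c s \<in> U" using c(2) s by auto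
  have N: "mink (n (X (c s))) w = 0" if "w \<in> range (frechet_derivative X (at (c s)))" for w
    using n cU that unfolding future_unit_normal_def by blast
  have et: "mink e (t s) = 0"
    using N[OF t_range[OF s]] by (simp add: e_def normal_along_def \<gamma>)
  have N': "timelike e" "mnorm e = 1" "mink e (axis 0 1) < 0"
    using n cU unfolding future_unit_normal_def e_def normal_along_def \<gamma> by auto
  have ee: "mink e e = - 1"
    using N'(1,2) by (simp add: timelike_def mnorm_def)
  have e0: "e $ 0 > 0"
    using N'(3) by (simp add: mink_def axis_def)
  have kn: "k_n n \<gamma> s = - mink e t'"
    by (simp add: k_n_def e_def t'_def t_def)
  have ew: "mink e w = 0" and tw: "mink (t s) w = 0"
    using ee et tt' by (simp_all add: w_def mink_linear kn mink_commute)
  have kg_w: "k_g n \<gamma> s = sqrt \<bar>mink w w\<bar>"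
    by (simp add: k_g_def mnorm_def w_def e_def t'_def t_def)
  with kg have "w \<noteq> 0" by (auto simp: mink_def)
  then have ww: "mink w w > 0"
    using orthogonal_timelike_imp_spacelike[of e w] ee ew by simp
  define l where "l = k_g n \<gamma> s"
  have l: "l > 0" "mink w w = l\<^sup>2"
    using ww by (simp_all add: l_def kg_w)
  have n1: "n_1 n \<gamma> s = (1 / l) *\<^sub>R w"
    by (simp add: n_1_def l_def w_def e_def t'_def t_def)
  have "t' = k_n n \<gamma> s *\<^sub>R e + l *\<^sub>R n_1 n \<gamma> s"
    using l by (simp add: n1 w_def)
  with t' show "(tangent \<gamma> has_vector_derivative
      k_n n \<gamma> s *\<^sub>R normal_along n \<gamma> s + k_g n \<gamma> s *\<^sub>R n_1 n \<gamma> s) (at s)"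
    by (simp add: t_def e_def l_def)
  show "pseudo_orthonormal (normal_along n \<gamma> s) (tangent \<gamma> s) (n_1 n \<gamma> s)"
    unfolding pseudo_orthonormal_def n1 e_def[symmetric] t_def[symmetric]
    using ee tt[OF s] et ew tw l by (simp add: mink_linear power2_eq_square)
  show "normal_along n \<gamma> s $ 0 > 0" using e0 by (simp add: e_def)
  show "k_g n \<gamma> s > 0" using l by (simp add: l_def)
qed

theorem corollary3p2:
  fixes U :: "(real^3) set" and X :: "real^3 \<Rightarrow> real^4" and n :: "real^4 \<Rightarrow> real^4"
    and I :: "real set" and c :: "real \<Rightarrow> real^3" and \<gamma> :: "real \<Rightarrow> real^4"
  assumes "spacelike_hypersurface U X"
    and "future_unit_normal U X n"
    and "open I" and "is_interval I"
    and "regular_curve_on I c" and "c ` I \<subseteq> U"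
    and "\<gamma> = X \<circ> c"
    and "unit_speed_on I \<gamma>"
    and "\<And>s. s \<in> I \<Longrightarrow> k_g n \<gamma> s \<noteq> 0"
    and "\<And>s. s \<in> I \<Longrightarrow> k_n n \<gamma> s * tau_2 n \<gamma> s + k_g n \<gamma> s * tau_g n \<gamma> s \<noteq> 0"
    and "\<And>s. s \<in> I \<Longrightarrow> (k_g n \<gamma> s)\<^sup>2 > (k_n n \<gamma> s)\<^sup>2"
  shows "(\<lambda>(s, \<theta>). hyperbolic_surface n \<gamma> s \<theta>) ` (I \<times> UNIV)
       = discriminant_set I hyperbolic_space (tangential_height \<gamma>)"
proof -
  have fibre: "(\<exists>\<theta>. v = hyperbolic_surface n \<gamma> s \<theta>) \<longleftrightarrow> v \<in> hyperbolic_space \<and>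
      tangential_height \<gamma> s v = 0 \<and> deriv (\<lambda>\<sigma>. tangential_height \<gamma> \<sigma> v) s = 0"
    if s: "s \<in> I" for s v
  proof -
    note frame = moving_frame[OF assms(1-3,5-8) s assms(9)[OF s]]
    have "((\<lambda>\<sigma>. mink (tangent \<gamma> \<sigma>) v) has_vector_derivative
        mink (k_n n \<gamma> s *\<^sub>R normal_along n \<gamma> s + k_g n \<gamma> s *\<^sub>R n_1 n \<gamma> s) v) (at s)"
      using bounded_bilinear.has_vector_derivative[OF bounded_bilinear_mink frame(1)
          has_vector_derivative_const[of v]] by (simp add: mink_def)
    then have "deriv (\<lambda>\<sigma>. tangential_height \<gamma> \<sigma> v) s =
        mink (k_n n \<gamma> s *\<^sub>R normal_along n \<gamma> s + k_g n \<gamma> s *\<^sub>R n_1 n \<gamma> s) v"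
      unfolding tangential_height_def
      by (intro DERIV_imp_deriv) (simp add: has_real_derivative_iff_has_vector_derivative)
    with hyperbolic_section_param[OF frame(2,3,4) assms(11)[OF s], of v] show ?thesis
      by (simp add: hyperbolic_surface_def tangential_height_def n_2_def)
  qed
  have "(\<lambda>(s, \<theta>). hyperbolic_surface n \<gamma> s \<theta>) ` (I \<times> UNIV)
      = {v. \<exists>s\<in>I. \<exists>\<theta>. v = hyperbolic_surface n \<gamma> s \<theta>}"
    by auto
  also have "\<dots> = discriminant_set I hyperbolic_space (tangential_height \<gamma>)"
    unfolding discriminant_set_def using fibre by blast
  finally show ?thesis .
qed

end
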